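(* Let $\Gamma \subseteq \mathcal{L}$ be a set of preference statements that is consistent and strongly compositional. Then every maximal $\models^*$-model of $\Gamma$ satisfies $\Gamma$. Moreover, if $\pi$ and $\pi'$ are two maximal $\models^*$-models of $\Gamma$, then $V_\pi = V_{\pi'}$.
   Context: Let $V$ be a finite set of variables, each $X\in V$ having a finite nonempty domain $\underline{X}$. An outcome is an assignment of a value in $\underline{X}$ to every $X\in V$; for an outcome $\alpha$ and $U\subseteq V$, $\alpha(U)$ denotes the restriction of $\alpha$ to $U$. A lexicographic model (lex model) $\pi$ is a (possibly empty) finite sequence $(Y_1,\ge_{Y_1}),\ldots,(Y_k,\ge_{Y_k})$ where the $Y_i\in V$ are pairwise distinct and each $\ge_{Y_i}$ is a total order on $\underline{Y_i}$; $V_\pi=\{Y_1,\ldots,Y_k\}$, and $\mathcal{G}$ is the set of all lex models. For outcomes $\alpha,\beta$: $\alpha\succ_\pi\beta$ iff there is $i$ with $\alpha(Y_j)=\beta(Y_j)$ for all $j<i$ and $\alpha(Y_i)>_{Y_i}\beta(Y_i)$ (strictly); $\alpha\equiv_\pi\beta$ iff $\alpha(V_\pi)=\beta(V_\pi)$; $\alpha\succcurlyeq_\pi\beta$ iff $\alpha\succ_\pi\beta$ or $\alpha\equiv_\pi\beta$. For lex models $\pi$ and $\pi'=(Z_1,\ge_{Z_1}),\ldots,(Z_l,\ge_{Z_l})$, the composition $\pi\circ\pi'$ is the sequence $\pi$ followed by the sequence obtained from $\pi'$ by deleting every pair $(Z_i,\ge_{Z_i})$ with $Z_i\in V_\pi$.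 We say $\pi'$ extends $\pi$ if $\pi'\neq\pi$ and the sequence $\pi'$ begins with the sequence $\pi$; $\pi'\sqsupseteq\pi$ means $\pi'$ extends or equals $\pi$. Let $\mathcal{L}$ be an arbitrary set (of preference statements) with a satisfaction relation $\models\ \subseteq\mathcal{G}\times\mathcal{L}$. For $\Gamma\subseteq\mathcal{L}$, $\pi\models\Gamma$ means $\pi\models\varphi$ for all $\varphi\in\Gamma$ ($\pi$ is then a model of $\Gamma$); $\Gamma$ is consistent if it has a model. Define $\pi\models^*\varphi$ iff there exists $\pi'\in\mathcal{G}$ with $\pi'\sqsupseteq\pi$ and $\pi'\models\varphi$; $\pi\models^*\Gamma$ iff $\pi\models^*\varphi$ for all $\varphi\in\Gamma$. A maximal $\models^*$-model of $\Gamma$ is a $\pi$ with $\pi\models^*\Gamma$ such that no lex model $\pi'$ extending $\pi$ has $\pi'\models^*\Gamma$. A statement $\varphi$ is strongly compositional if for all $\pi,\pi'\in\mathcal{G}$, $\pi\models^*\varphi$ and $\pi'\models\varphi$ imply $\pi\circ\pi'\models\varphi$; a set $\Gamma$ is strongly compositional if each of its elements is. *)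

theory Defs
  imports Main "HOL-Library.Sublist"
begin

text \<open>
  Variables are the elements of \<open>V\<close>, and \<open>D X\<close> is the domain of \<open>X\<close>.  A pair \<open>(Y, R)\<close> stands for
  \<open>(Y, \<ge>\<^sub>Y)\<close>, where \<open>(x, y) \<in> R\<close> means \<open>x \<ge>\<^sub>Y y\<close>; \<open>linear_order_on (D Y) R\<close> also forces
  \<open>R \<subseteq> D Y \<times> D Y\<close>, so that equality of lists is equality of lex models.
\<close>

type_synonym ('v, 'a) lex_model = "('v \<times> 'a rel) list"

definition lex_models :: "'v set \<Rightarrow> ('v \<Rightarrow> 'a set) \<Rightarrow> ('v, 'a) lex_model set" where
  "lex_models V D =
     {\<pi>. distinct (map fst \<pi>) \<and> (\<forall>(Y, R)\<in>set \<pi>. Y \<in> V \<and> linear_order_on (D Y) R)}"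

definition model_vars :: "('v, 'a) lex_model \<Rightarrow> 'v set" where
  "model_vars \<pi> = fst ` set \<pi>"

definition lex_comp :: "('v, 'a) lex_model \<Rightarrow> ('v, 'a) lex_model \<Rightarrow> ('v, 'a) lex_model" where
  "lex_comp \<pi> \<pi>' = \<pi> @ filter (\<lambda>(Z, R). Z \<notin> model_vars \<pi>) \<pi>'"

text \<open>
  The satisfaction relation is an arbitrary set of pairs \<open>sat\<close>.  The library's \<open>strict_prefix \<pi> \<pi>'\<close>
  says that \<open>\<pi>'\<close> extends \<open>\<pi>\<close>, and \<open>prefix \<pi> \<pi>'\<close> that \<open>\<pi>'\<close> extends or equals \<open>\<pi>\<close>.
\<close>

definition satisfies :: "(('v, 'a) lex_model \<times> 's) set \<Rightarrow> ('v, 'a) lex_model \<Rightarrow> 's set \<Rightarrow> bool" where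
  "satisfies sat \<pi> \<Gamma> \<longleftrightarrow> (\<forall>\<phi>\<in>\<Gamma>. (\<pi>, \<phi>) \<in> sat)"

definition consistent ::
  "'v set \<Rightarrow> ('v \<Rightarrow> 'a set) \<Rightarrow> (('v, 'a) lex_model \<times> 's) set \<Rightarrow> 's set \<Rightarrow> bool" where
  "consistent V D sat \<Gamma> \<longleftrightarrow> (\<exists>\<pi>\<in>lex_models V D. satisfies sat \<pi> \<Gamma>)"

definition sat_star ::
  "'v set \<Rightarrow> ('v \<Rightarrow> 'a set) \<Rightarrow> (('v, 'a) lex_model \<times> 's) set \<Rightarrow> (('v, 'a) lex_model \<times> 's) set" where
  "sat_star V D sat =
     {(\<pi>, \<phi>). \<pi> \<in> lex_models V D \<and> (\<exists>\<pi>'\<in>lex_models V D. prefix \<pi> \<pi>' \<and> (\<pi>', \<phi>) \<in> sat)}"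

definition maximal_star_model ::
  "'v set \<Rightarrow> ('v \<Rightarrow> 'a set) \<Rightarrow> (('v, 'a) lex_model \<times> 's) set \<Rightarrow> 's set \<Rightarrow> ('v, 'a) lex_model \<Rightarrow> bool" where
  "maximal_star_model V D sat \<Gamma> \<pi> \<longleftrightarrow>
     \<pi> \<in> lex_models V D \<and> satisfies (sat_star V D sat) \<pi> \<Gamma> \<and>
     \<not> (\<exists>\<pi>'\<in>lex_models V D. strict_prefix \<pi> \<pi>' \<and> satisfies (sat_star V D sat) \<pi>' \<Gamma>)"

definition strongly_compositional ::
  "'v set \<Rightarrow> ('v \<Rightarrow> 'a set) \<Rightarrow> (('v, 'a) lex_model \<times> 's) set \<Rightarrow> 's \<Rightarrow> bool" where
  "strongly_compositional V D sat \<phi> \<longleftrightarrow>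
     (\<forall>\<pi>\<in>lex_models V D. \<forall>\<pi>'\<in>lex_models V D.
        (\<pi>, \<phi>) \<in> sat_star V D sat \<longrightarrow> (\<pi>', \<phi>) \<in> sat \<longrightarrow> (lex_comp \<pi> \<pi>', \<phi>) \<in> sat)"

definition strongly_compositional_set ::
  "'v set \<Rightarrow> ('v \<Rightarrow> 'a set) \<Rightarrow> (('v, 'a) lex_model \<times> 's) set \<Rightarrow> 's set \<Rightarrow> bool" where
  "strongly_compositional_set V D sat \<Gamma> \<longleftrightarrow> (\<forall>\<phi>\<in>\<Gamma>. strongly_compositional V D sat \<phi>)"

end

(* If \<pi> is a maximal star model of \<Gamma> and \<mu> is any model of \<Gamma>, strong compositionality makes
   \<pi> \<circ> \<mu> a model of \<Gamma>.  It begins with \<pi>, so maximality forces \<pi> \<circ> \<mu> = \<pi>: hence \<pi> itself is a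
   model of \<Gamma>, and it already contains every variable of \<mu>. *)
theory Submission
  imports Defs
begin

lemma lex_comp_in_lex_models:
  assumes "\<pi> \<in> lex_models V D" and "\<mu> \<in> lex_models V D"
  shows "lex_comp \<pi> \<mu> \<in> lex_models V D"
  using assms
  by (auto simp: lex_models_def lex_comp_def model_vars_def distinct_map_filter intro: rev_image_eqI)

lemma prefix_lex_comp: "prefix \<pi> (lex_comp \<pi> \<mu>)"
  by (simp add: lex_comp_def)

text \<open>Both sides say that the filter in \<open>lex_comp\<close> deletes every pair of
  \<open>\<mu>\<close>. This turns an equality of sequences into an inclusion of variable
  sets.\<close>

lemma lex_comp_eq_left_iff: "lex_comp \<pi> \<mu> = \<pi> \<longleftrightarrow> model_vars \<mu> \<subseteq> model_vars \<pi>"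
  by (auto simp: lex_comp_def model_vars_def filter_empty_conv split_beta)

lemma satisfies_imp_satisfies_sat_star:
  assumes "\<pi> \<in> lex_models V D" and "satisfies sat \<pi> \<Gamma>"
  shows "satisfies (sat_star V D sat) \<pi> \<Gamma>"
  using assms by (auto simp: satisfies_def sat_star_def)

text \<open>The extensions of \<open>\<pi>\<close> witnessing \<open>sat_star\<close> may differ
  from one \<phi> to another; the single model \<open>\<mu>\<close> yields one composition that
  works for all \<phi> in \<Gamma>.\<close>

lemma satisfies_lex_comp:
  assumes "strongly_compositional_set V D sat \<Gamma>"
    and "\<pi> \<in> lex_models V D" and "satisfies (sat_star V D sat) \<pi> \<Gamma>"
    and "\<mu> \<in> lex_models V D" and "satisfies sat \<mu> \<Gamma>"
  shows "satisfies sat (lex_comp \<pi> \<mu>) \<Gamma>"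
  using assms
  by (auto simp: satisfies_def strongly_compositional_set_def strongly_compositional_def)

text \<open>Kept general in \<open>\<mu>\<close> because it is applied both to a model given by
  consistency and to a second maximal model.\<close>

lemma maximal_star_model_absorbs_models:
  assumes comp: "strongly_compositional_set V D sat \<Gamma>"
    and max: "maximal_star_model V D sat \<Gamma> \<pi>"
    and \<mu>: "\<mu> \<in> lex_models V D" "satisfies sat \<mu> \<Gamma>"
  shows "satisfies sat \<pi> \<Gamma>" and "model_vars \<mu> \<subseteq> model_vars \<pi>"
proof -
  have \<pi>: "\<pi> \<in> lex_models V D" "satisfies (sat_star V D sat) \<pi> \<Gamma>"
    using max by (simp_all add: maximal_star_model_def)
  have model: "satisfies sat (lex_comp \<pi> \<mu>) \<Gamma>"
    using comp \<pi> \<mu> by (rule satisfies_lex_comp)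
  have lex: "lex_comp \<pi> \<mu> \<in> lex_models V D"
    using \<pi>(1) \<mu>(1) by (rule lex_comp_in_lex_models)
  \<comment> \<open>Every model is a star model, with itself as the witnessing extension, so
    maximality rules out the composition as a proper extension.\<close>
  have "\<not> strict_prefix \<pi> (lex_comp \<pi> \<mu>)"
    using max lex satisfies_imp_satisfies_sat_star[OF lex model]
    by (auto simp: maximal_star_model_def)
  then have eq: "lex_comp \<pi> \<mu> = \<pi>"
    using prefix_lex_comp[of \<pi> \<mu>] by (auto simp: strict_prefix_def)
  show "satisfies sat \<pi> \<Gamma>"
    using model by (simp add: eq)
  show "model_vars \<mu> \<subseteq> model_vars \<pi>"
    using eq by (simp add: lex_comp_eq_left_iff)
qed

theorem theorem1:
  fixes V :: "'v set" and D :: "'v \<Rightarrow> 'a set"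
    and L :: "'s set" and sat :: "(('v, 'a) lex_model \<times> 's) set" and \<Gamma> :: "'s set"
  assumes "finite V"
    and "\<forall>X\<in>V. finite (D X) \<and> D X \<noteq> {}"
    and "sat \<subseteq> lex_models V D \<times> L"
    and "\<Gamma> \<subseteq> L"
    and "consistent V D sat \<Gamma>"
    and "strongly_compositional_set V D sat \<Gamma>"
  shows "(\<forall>\<pi>. maximal_star_model V D sat \<Gamma> \<pi> \<longrightarrow> satisfies sat \<pi> \<Gamma>) \<and>
    (\<forall>\<pi> \<pi>'. maximal_star_model V D sat \<Gamma> \<pi> \<and> maximal_star_model V D sat \<Gamma> \<pi>' \<longrightarrow>
       model_vars \<pi> = model_vars \<pi>')"
proof -
  obtain \<mu> where \<mu>: "\<mu> \<in> lex_models V D" "satisfies sat \<mu> \<Gamma>"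
    using assms(5) by (auto simp: consistent_def)
  have model: "satisfies sat \<pi> \<Gamma>" if "maximal_star_model V D sat \<Gamma> \<pi>" for \<pi>
    using assms(6) that \<mu> by (rule maximal_star_model_absorbs_models(1))
  \<comment> \<open>One inclusion suffices: exchanging the two maximal models gives the
    other.\<close>
  have "model_vars \<pi>' \<subseteq> model_vars \<pi>"
    if "maximal_star_model V D sat \<Gamma> \<pi>" and max': "maximal_star_model V D sat \<Gamma> \<pi>'" for \<pi> \<pi>'
  proof -
    have "\<pi>' \<in> lex_models V D"
      using max' by (simp add: maximal_star_model_def)
    \<comment> \<open>By the first claim \<open>\<pi>'\<close> is itself a model of \<Gamma>, so it
      can take the place of \<open>\<mu>\<close>.\<close>
    with assms(6) that(1) show ?thesis
      using model[OF max'] by (rule maximal_star_model_absorbs_models(2))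
  qed
  with model show ?thesis
    by blast
qed

end
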